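(* Let $r$ be a positive integer and $R=\lfloor r/2\rfloor$. Let $D$ be a Golomb ruler, and define $f(i,j)=iR+j(R+1)+R^2+R$. Let $\mathcal{A}=\{(i,j)\in\mathbb{Z}^2: |i|+|j|\le R\}$ be the Lee sphere of radius $R$ centred at $(0,0)$, and place a dot at $(i,j)\in\mathcal{A}$ if and only if $f(i,j)\in D$. Then the set of dots is a $\overline{\mathrm{DD}}(m,r)$, where $m=|D\cap\{0,1,\ldots,2R^2+2R\}|$.
   Context: A Golomb ruler is a finite set $D$ of integers such that all differences $a-b$ with $a,b\in D$, $a\ne b$, are distinct. The square grid is $\mathbb{Z}^2$ with Manhattan distance $d((i_1,j_1),(i_2,j_2))=|i_2-i_1|+|j_2-j_1|$. A $\overline{\mathrm{DD}}(m,r)$ is a set of $m$ points ("dots") of $\mathbb{Z}^2$ such that any two dots are at Manhattan distance at most $r$ and the vectors $a-b$, over ordered pairs $(a,b)$ of distinct dots, are pairwise distinct. *)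

theory Defs
  imports Main "HOL-Library.Product_Plus"
begin

definition distinct_differences :: "'a::group_add set \<Rightarrow> bool" where
  "distinct_differences S \<longleftrightarrow>
     inj_on (\<lambda>(a, b). a - b) {(a, b). a \<in> S \<and> b \<in> S \<and> a \<noteq> b}"

definition golomb_ruler :: "int set \<Rightarrow> bool" where
  "golomb_ruler D \<longleftrightarrow> finite D \<and> distinct_differences D"

definition manhattan :: "int \<times> int \<Rightarrow> int \<times> int \<Rightarrow> int" where
  "manhattan p q = \<bar>fst q - fst p\<bar> + \<bar>snd q - snd p\<bar>"

(* Finiteness is required explicitly because the cardinality of an infinite set is 0. *)
definition DD_bar :: "nat \<Rightarrow> int \<Rightarrow> (int \<times> int) set \<Rightarrow> bool" where
  "DD_bar m r S \<longleftrightarrow>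
     finite S \<and> card S = m \<and>
     (\<forall>a\<in>S. \<forall>b\<in>S. manhattan a b \<le> r) \<and>
     distinct_differences S"

definition lee_sphere :: "int \<Rightarrow> (int \<times> int) set" where
  "lee_sphere R = {(i, j). \<bar>i\<bar> + \<bar>j\<bar> \<le> R}"

end

theory Submission
  imports Defs
begin

text \<open>
  In the coordinates \<open>s = i + j\<close> and \<open>j\<close> the map \<open>f\<close> is \<open>s R + j\<close> up to a constant, and
  \<open>|i| + |j| = max |s| |s - 2 j|\<close>. So \<open>s R + j = m\<close> has a solution in the Lee sphere exactly when
  some \<open>s\<close> satisfies \<open>|s| \<le> R\<close> and \<open>|s (2 R + 1) - 2 m| \<le> R\<close>. Exactly one \<open>s\<close> satisfies the
  second condition, since an interval of \<open>2 R + 1\<close> consecutive integers contains one multiple of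
  \<open>2 R + 1\<close>, and it satisfies the first one when \<open>|m| \<le> R\<^sup>2 + R\<close>. Hence \<open>f\<close> is a
  bijection from the Lee sphere onto \<open>{0..2 R\<^sup>2 + 2 R}\<close>. Being affine, it maps equal difference
  vectors to equal differences, so distinctness of differences is inherited from the ruler.
\<close>

lemma lee_sphere_iff:
  "(i, j) \<in> lee_sphere R \<longleftrightarrow> \<bar>i + j\<bar> \<le> R \<and> \<bar>i - j\<bar> \<le> R"
  by (auto simp: lee_sphere_def)

lemma manhattan_lee_sphere:
  assumes "p \<in> lee_sphere R" "q \<in> lee_sphere R"
  shows "manhattan p q \<le> 2 * R"
  using assms by (cases p; cases q) (auto simp: lee_sphere_def manhattan_def)

text \<open>Integrality turns a strict bound between multiples of \<open>2 * R + 1\<close> into a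
  weak bound between the coordinates \<open>s\<close>.\<close>

lemma lt_mult_cancel_succ:
  fixes a b c :: int
  assumes "c > 0" "a * c < (b + 1) * c"
  shows "a \<le> b"
  using assms by (simp add: mult_less_cancel_right_pos)

lemma bij_betw_lee_sphere:
  fixes R :: int
  assumes R: "R \<ge> 0"
  shows "bij_betw (\<lambda>(i, j). i * R + j * (R + 1) + R\<^sup>2 + R)
           (lee_sphere R) {0..2 * R\<^sup>2 + 2 * R}"
    (is "bij_betw ?f _ _")
proof (rule bij_betw_imageI)
  show "inj_on ?f (lee_sphere R)"
  proof (rule inj_onI, clarify)
    fix i j i' j' :: int
    assume p: "(i, j) \<in> lee_sphere R" and q: "(i', j') \<in> lee_sphere R"
      and eq: "i * R + j * (R + 1) + R\<^sup>2 + R = i' * R + j' * (R + 1) + R\<^sup>2 + R"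
    \<comment> \<open>Each side is twice the linear part of \<open>f\<close>.\<close>
    have key: "(i + j) * (2 * R + 1) - (i - j) = (i' + j') * (2 * R + 1) - (i' - j')"
      using eq by (simp add: algebra_simps)
    have diff: "\<bar>i - j\<bar> \<le> R" "\<bar>i' - j'\<bar> \<le> R"
      using p q by (simp_all add: lee_sphere_iff)
    \<comment> \<open>\<open>i - j\<close> and \<open>i' - j'\<close> differ by at most
      \<open>2 * R\<close>, less than one modulus.\<close>
    have "(i + j) * (2 * R + 1) < (i' + j' + 1) * (2 * R + 1)"
      using key diff by (simp add: algebra_simps abs_le_iff)
    then have "i + j \<le> i' + j'"
      using R by (intro lt_mult_cancel_succ[of "2 * R + 1"]) auto
    moreover have "(i' + j') * (2 * R + 1) < (i + j + 1) * (2 * R + 1)"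
      using key diff by (simp add: algebra_simps abs_le_iff)
    then have "i' + j' \<le> i + j"
      using R by (intro lt_mult_cancel_succ[of "2 * R + 1"]) auto
    ultimately have s: "i + j = i' + j'"
      by simp
    then have "i - j = i' - j'"
      using key by simp
    with s show "i = i' \<and> j = j'"
      by linarith
  qed
  show "?f ` lee_sphere R = {0..2 * R\<^sup>2 + 2 * R}"
  proof (intro equalityI subsetI)
    fix n assume "n \<in> ?f ` lee_sphere R"
    then obtain i j where ij: "(i, j) \<in> lee_sphere R"
      and n: "n = (i + j) * R + j + R\<^sup>2 + R"
      by (auto simp: algebra_simps)
    have "\<bar>(i + j) * R\<bar> \<le> R\<^sup>2"
      using ij R by (simp add: lee_sphere_iff abs_mult power2_eq_square mult_right_mono)
    moreover have "\<bar>j\<bar> \<le> R"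
      using ij by (auto simp: lee_sphere_def)
    ultimately show "n \<in> {0..2 * R\<^sup>2 + 2 * R}"
      using n by auto
  next
    fix n assume n: "n \<in> {0..2 * R\<^sup>2 + 2 * R}"
    define m where "m = n - R\<^sup>2 - R"
    \<comment> \<open>the integer nearest to \<open>2 m / (2 R + 1)\<close>\<close>
    define s where "s = (2 * m + R) div (2 * R + 1)"
    define j where "j = m - s * R"
    have div_mod: "s * (2 * R + 1) + (2 * m + R) mod (2 * R + 1) = 2 * m + R"
      unfolding s_def by (rule div_mult_mod_eq)
    have "0 \<le> (2 * m + R) mod (2 * R + 1)" "(2 * m + R) mod (2 * R + 1) < 2 * R + 1"
      using R by (intro pos_mod_sign pos_mod_bound; linarith)+
    with div_mod have near: "s * (2 * R + 1) \<le> 2 * m + R" "2 * m - R \<le> s * (2 * R + 1)"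
      by linarith+
    \<comment> \<open>As \<open>\<bar>m\<bar> \<le> R\<^sup>2 + R\<close>, \<open>near\<close>
      bounds \<open>\<bar>s\<bar> * (2 * R + 1)\<close> by \<open>2 * R\<^sup>2 + 3 * R\<close>,
      just one below this product.\<close>
    have top: "(R + 1) * (2 * R + 1) = 2 * R\<^sup>2 + 3 * R + 1"
      by (simp add: algebra_simps power2_eq_square)
    have "s * (2 * R + 1) < (R + 1) * (2 * R + 1)"
      using near n unfolding top m_def by simp
    then have "s \<le> R"
      using R by (intro lt_mult_cancel_succ[of "2 * R + 1"]) auto
    moreover have "- s * (2 * R + 1) < (R + 1) * (2 * R + 1)"
      using near n unfolding top m_def by simp
    then have "- s \<le> R"
      using R by (intro lt_mult_cancel_succ[of "2 * R + 1"]) auto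
    \<comment> \<open>Here \<open>s - 2 * j = s * (2 * R + 1) - 2 * m\<close>.\<close>
    moreover have "\<bar>s - 2 * j\<bar> \<le> R"
      using near by (simp add: j_def algebra_simps)
    ultimately have "(s - j, j) \<in> lee_sphere R"
      by (simp add: lee_sphere_iff)
    moreover have "n = ?f (s - j, j)"
      by (simp add: j_def m_def algebra_simps)
    ultimately show "n \<in> ?f ` lee_sphere R"
      by blast
  qed
qed

lemma distinct_differences_inj_on:
  assumes D: "distinct_differences D" and inj: "inj_on h S" and sub: "h ` S \<subseteq> D"
    and diff: "\<And>a b c d. a - b = c - d \<Longrightarrow> h a - h b = h c - h d"
  shows "distinct_differences S"
  unfolding distinct_differences_def
proof (rule inj_onI, clarify)
  fix a b c d
  assume S: "a \<in> S" "b \<in> S" "c \<in> S" "d \<in> S"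
    and neq: "a \<noteq> b" "c \<noteq> d" and eq: "a - b = c - d"
  \<comment> \<open>The hypothesis on \<open>D\<close> covers only pairs of distinct
    elements.\<close>
  have "h a \<noteq> h b" "h c \<noteq> h d"
    using S neq inj by (auto dest: inj_onD)
  moreover have "h a \<in> D" "h b \<in> D" "h c \<in> D" "h d \<in> D"
    using S sub by auto
  ultimately have "(h a, h b) = (h c, h d)"
    using diff[OF eq]
    by (intro inj_onD[OF D[unfolded distinct_differences_def]]) auto
  then show "a = c \<and> b = d"
    using S inj by (auto dest: inj_onD)
qed

theorem theorem16:
  fixes r R :: int and D :: "int set" and f :: "int \<Rightarrow> int \<Rightarrow> int"
  assumes "r > 0"
    and "R = r div 2"
    and "golomb_ruler D"
    and "\<And>i j. f i j = i * R + j * (R + 1) + R\<^sup>2 + R"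
  shows "DD_bar (card (D \<inter> {0..2 * R\<^sup>2 + 2 * R})) r
           {(i, j). (i, j) \<in> lee_sphere R \<and> f i j \<in> D}"
proof -
  let ?S = "{(i, j). (i, j) \<in> lee_sphere R \<and> f i j \<in> D}"
  let ?h = "\<lambda>(i, j). f i j"
  have R: "R \<ge> 0" "2 * R \<le> r"
    using assms(1,2) by auto
  have bij: "bij_betw ?h (lee_sphere R) {0..2 * R\<^sup>2 + 2 * R}"
    using bij_betw_lee_sphere[OF R(1)] by (simp add: assms(4))
  have "?h ` ?S = D \<inter> ?h ` lee_sphere R"
    by auto
  then have "?h ` ?S = D \<inter> {0..2 * R\<^sup>2 + 2 * R}"
    using bij by (simp add: bij_betw_def)
  moreover have inj: "inj_on ?h ?S"
    using bij by (rule inj_on_subset[OF bij_betw_imp_inj_on]) auto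
  ultimately have S: "bij_betw ?h ?S (D \<inter> {0..2 * R\<^sup>2 + 2 * R})"
    by (simp add: bij_betw_def)
  have "distinct_differences ?S"
  proof (rule distinct_differences_inj_on[OF _ inj])
    show "distinct_differences D"
      using assms(3) by (simp add: golomb_ruler_def)
    fix a b c d :: "int \<times> int"
    assume eq: "a - b = c - d"
    \<comment> \<open>The constant \<open>R\<^sup>2 + R\<close> cancels, leaving a function of
      \<open>p - q\<close> alone.\<close>
    have h: "?h p - ?h q = fst (p - q) * R + snd (p - q) * (R + 1)" for p q
      by (cases p; cases q) (simp add: assms(4) algebra_simps)
    show "?h a - ?h b = ?h c - ?h d"
      unfolding h eq ..
  qed auto
  moreover have "finite ?S"
    using bij_betw_finite[OF S] by simp
  moreover have "manhattan p q \<le> r" if "p \<in> ?S" "q \<in> ?S" for p q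
    using manhattan_lee_sphere[of p R q] that R(2) by auto
  ultimately show ?thesis
    using bij_betw_same_card[OF S] unfolding DD_bar_def by blast
qed

end
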